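(* For all integers $n,m\ge0$ and all real $x,y$ with $1+\lambda x>0$, \[ B_{n+m,\lambda}(x,y)=\sum_{j=0}^{m}\sum_{k=0}^{n}{m\brace j}_\lambda\binom{n}{k}(j-m\lambda)_{n-k,\lambda}(y)_{j,\lambda}\,x^j\,B_{k,\lambda}(x,y-j\lambda), \] and \[ B_{n+m,\lambda}(x)=\sum_{j=0}^{m}\sum_{k=0}^{n}{m\brace j}_\lambda\binom{n}{k}(j-m\lambda)_{n-k,\lambda}(1)_{j,\lambda}\,x^j\,B_{k,\lambda}(x,1-j\lambda). \]
   Context: Let $\lambda$ be a fixed nonzero real number. The degenerate falling factorial is $(x)_{0,\lambda}=1$ and $(x)_{n,\lambda}=x(x-\lambda)\cdots(x-(n-1)\lambda)$ for $n\ge1$. The degenerate exponential is $e_\lambda^{x}(t)=(1+\lambda t)^{x/\lambda}=\sum_{n\ge0}(x)_{n,\lambda}\frac{t^n}{n!}$, and $e_\lambda(t)=e_\lambda^1(t)$. The degenerate Stirling numbers of the second kind ${n\brace k}_\lambda$ are defined by $\frac{1}{k!}(e_\lambda(t)-1)^k=\sum_{n\ge k}{n\brace k}_\lambda\frac{t^n}{n!}$ for $k\ge0$. For real $x,y$ with $1+\lambda x>0$, the fully degenerate Bell polynomials $B_{n,\lambda}(x)$ and the two variable fully degenerate Bell polynomials $B_{n,\lambda}(x,y)$ are defined by the formal power series identities in $t$ \[ \frac{e_\lambda(xe_\lambda(t))}{e_\lambda(x)}=\sum_{n\ge0}B_{n,\lambda}(x)\frac{t^n}{n!},\qquad \frac{e^{y}_\lambda(xe_\lambda(t))}{e_\lambda(x)}=\sum_{n\ge0}B_{n,\lambda}(x,y)\frac{t^n}{n!},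 \] where $e_\lambda^{y}(xe_\lambda(t))=(1+\lambda x e_\lambda(t))^{y/\lambda}$ and $e_\lambda(x)=(1+\lambda x)^{1/\lambda}$. *)

theory Defs
  imports Complex_Main "HOL-Computational_Algebra.Formal_Power_Series"
begin

text \<open>
  Real powers of a formal power series with positive constant term \<open>c\<close>:
  \<open>F\<^sup>a = c\<^sup>a (1 + (F / c - 1))\<^sup>a\<close>, where the second factor is the binomial series
  composed with a series that has no constant term. The value is meaningful only for \<open>c > 0\<close>.
\<close>

definition fps_powr :: "real fps \<Rightarrow> real \<Rightarrow> real fps" where
  "fps_powr F a =
     fps_const (fps_nth F 0 powr a) *
     (fps_binomial a oo (fps_const (1 / fps_nth F 0) * F - 1))"

lemma fps_powr_nth_0: "fps_nth (fps_powr F a) 0 = fps_nth F 0 powr a"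
  by (simp add: fps_powr_def)

lemma fps_powr_add:
  assumes "fps_nth F 0 > 0"
  shows "fps_powr F (a + b) = fps_powr F a * fps_powr F b"
proof -
  have "fps_nth (fps_const (1 / fps_nth F 0) * F - 1) 0 = 0"
    using assms by simp
  from fps_compose_mult_distrib[OF this] show ?thesis
    by (simp add: fps_powr_def fps_binomial_add_mult powr_add
        flip: fps_const_mult)
qed

lemma fps_powr_of_nat:
  assumes "fps_nth F 0 > 0"
  shows "fps_powr F (of_nat n) = F ^ n"
proof (induction n)
  case 0
  show ?case using assms by (simp add: fps_powr_def)
next
  case (Suc n)
  have "fps_nth (fps_const (1 / fps_nth F 0) * F - 1) 0 = 0"
    using assms by simp
  then have "fps_powr F 1 = fps_const (fps_nth F 0) * (fps_const (1 / fps_nth F 0) * F)"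
    using assms by (simp add: fps_powr_def fps_binomial_1 fps_compose_add_distrib)
  also have "\<dots> = F"
    using assms by (simp add: mult.assoc[symmetric] fps_const_mult)
  finally have one: "fps_powr F 1 = F" .
  have "fps_powr F (of_nat (Suc n)) = fps_powr F (1 + of_nat n)"
    by simp
  also have "\<dots> = F * F ^ n"
    unfolding fps_powr_add[OF assms] one Suc.IH ..
  finally show ?case by simp
qed

definition degen_ffact :: "real \<Rightarrow> real \<Rightarrow> nat \<Rightarrow> real" where
  "degen_ffact lam x n = (\<Prod>i<n. x - real i * lam)"

text \<open>
  The degenerate exponential \<open>(1 + \<lambda> F)\<^bsup>y/\<lambda>\<^esup>\<close> with a formal power series \<open>F\<close> as argument;
  \<open>F\<close> may have a nonzero constant term \<open>c\<close> provided that \<open>1 + \<lambda> c > 0\<close>.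
\<close>

definition degen_exp :: "real \<Rightarrow> real \<Rightarrow> real fps \<Rightarrow> real fps" where
  "degen_exp lam y F = fps_powr (1 + fps_const lam * F) (y / lam)"

definition degen_exp_real :: "real \<Rightarrow> real \<Rightarrow> real" where
  "degen_exp_real lam x = (1 + lam * x) powr (1 / lam)"

lemma degen_exp_fps_X:
  assumes "lam \<noteq> 0"
  shows "degen_exp lam x fps_X = Abs_fps (\<lambda>n. degen_ffact lam x n / fact n)"
proof (rule fps_ext)
  fix n
  have "(\<Prod>i<n. x / lam - real i) * lam ^ n = (\<Prod>i<n. (x / lam - real i) * lam)"
    by (simp add: prod.distrib)
  also have "\<dots> = (\<Prod>i<n. x - real i * lam)"
    using assms by (simp add: algebra_simps)
  finally have prod: "(\<Prod>i<n. x / lam - real i) * lam ^ n = (\<Prod>i<n. x - real i * lam)" .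
  have "degen_exp lam x fps_X = fps_binomial (x / lam) oo (fps_const lam * fps_X)"
    by (simp add: degen_exp_def fps_powr_def)
  then have "fps_nth (degen_exp lam x fps_X) n = ((x / lam) gchoose n) * lam ^ n"
    by (simp only: fps_compose_linear) simp
  then show "fps_nth (degen_exp lam x fps_X) n =
      fps_nth (Abs_fps (\<lambda>n. degen_ffact lam x n / fact n)) n"
    by (simp add: degen_ffact_def gbinomial_prod_rev atLeast0LessThan prod)
qed

definition degen_Stirling2 :: "real \<Rightarrow> nat \<Rightarrow> nat \<Rightarrow> real" where
  "degen_Stirling2 lam n k =
     fact n * fps_nth (fps_const (1 / fact k) * (degen_exp lam 1 fps_X - 1) ^ k) n"

lemma degen_Stirling2_eq_0: "n < k \<Longrightarrow> degen_Stirling2 lam n k = 0"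
proof -
  assume "n < k"
  moreover have "fps_nth (degen_exp lam 1 fps_X - 1) 0 = 0"
    by (simp add: degen_exp_def fps_powr_nth_0)
  ultimately show ?thesis
    by (simp add: degen_Stirling2_def startsby_zero_power_prefix)
qed

definition degen_Bell :: "real \<Rightarrow> nat \<Rightarrow> real \<Rightarrow> real" where
  "degen_Bell lam n x =
     fact n * fps_nth (degen_exp lam 1 (fps_const x * degen_exp lam 1 fps_X)
                         / fps_const (degen_exp_real lam x)) n"

definition degen_Bell2 :: "real \<Rightarrow> nat \<Rightarrow> real \<Rightarrow> real \<Rightarrow> real" where
  "degen_Bell2 lam n x y =
     fact n * fps_nth (degen_exp lam y (fps_const x * degen_exp lam 1 fps_X)
                         / fps_const (degen_exp_real lam x)) n"

end

theory Submission
  imports Defs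
begin

text \<open>
  Write \<open>E\<^sup>a\<close> for the degenerate exponential with exponent \<open>a\<close> at \<open>t\<close>, and \<open>G\<^sub>y\<close> for the generating
  function of the \<open>B\<^sub>n(x, y)\<close>. The chain rule gives \<open>D E\<^sup>a = a E\<^bsup>a-\<lambda>\<^esup>\<close> and
  \<open>D G\<^sub>y = y x E\<^bsup>1-\<lambda>\<^esup> G\<^bsub>y-\<lambda>\<^esub>\<close>. Since the degenerate Stirling numbers satisfy
  \<open>S(m+1, j) = S(m, j-1) + (j - m\<lambda>) S(m, j)\<close>, induction on \<open>m\<close> yields
  \<open>D\<^sup>m G\<^sub>y = \<Sum>\<^sub>j S(m, j) (y)\<^sub>j x\<^sup>j E\<^bsup>j-m\<lambda>\<^esup> G\<^bsub>y-j\<lambda>\<^esub>\<close>. The theorem is the comparison of the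
  coefficients of \<open>t\<^sup>n\<close>.
\<close>

lemma fps_deriv_binomial:
  "fps_deriv (fps_binomial a) = fps_const a * fps_binomial (a - 1)" for a :: real
proof (rule fps_ext)
  fix n
  show "fps_nth (fps_deriv (fps_binomial a)) n = fps_nth (fps_const a * fps_binomial (a - 1)) n"
    using gbinomial_absorption[of n a] by simp
qed

text \<open>\<open>fps_powr\<close> is c^a times the binomial series at H = F/c - 1. The chain rule
  gives a factor H' = F'/c, and its 1/c turns c^a into the c^(a-1) that belongs to
  \<open>fps_powr F (a - 1)\<close>.\<close>

lemma fps_deriv_powr:
  assumes "fps_nth F 0 > 0"
  shows "fps_deriv (fps_powr F a) = fps_const a * fps_deriv F * fps_powr F (a - 1)"
proof -
  define c where "c = fps_nth F 0"
  define H where "H = fps_const (1 / c) * F - 1"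
  have c: "c > 0" and H: "fps_nth H 0 = 0"
    using assms by (simp_all add: c_def H_def)
  have "fps_deriv (fps_powr F a) =
      fps_const (c powr a) * ((fps_const a * fps_binomial (a - 1)) oo H) * fps_deriv H"
    by (simp add: fps_powr_def fps_compose_deriv[OF H] fps_deriv_binomial mult.assoc
        flip: c_def H_def)
  also have "\<dots> = fps_const (c powr a) * (fps_const a * (fps_binomial (a - 1) oo H)) *
      (fps_const (1 / c) * fps_deriv F)"
    by (simp add: fps_compose_mult_distrib[OF H]) (simp add: H_def)
  also have "\<dots> = fps_const a * fps_deriv F *
      ((fps_const (c powr a) * fps_const (1 / c)) * (fps_binomial (a - 1) oo H))"
    by (simp only: ac_simps)
  also have "fps_const (c powr a) * fps_const (1 / c) = fps_const (c powr (a - 1))"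
    using c by (simp add: powr_diff)
  finally show ?thesis
    by (simp add: fps_powr_def c_def H_def)
qed

lemma degen_exp_add:
  assumes "1 + lam * fps_nth F 0 > 0"
  shows "degen_exp lam (a + b) F = degen_exp lam a F * degen_exp lam b F"
  using assms by (simp add: degen_exp_def add_divide_distrib fps_powr_add)

lemma degen_exp_0:
  assumes "1 + lam * fps_nth F 0 > 0"
  shows "degen_exp lam 0 F = 1"
  using fps_powr_of_nat[of "1 + fps_const lam * F" 0] assms by (simp add: degen_exp_def)

lemma degen_exp_lam:
  assumes "lam \<noteq> 0" and "1 + lam * fps_nth F 0 > 0"
  shows "degen_exp lam lam F = 1 + fps_const lam * F"
  using fps_powr_of_nat[of "1 + fps_const lam * F" 1] assms by (simp add: degen_exp_def)

text \<open>The exponent y/lam drops by 1 to (y - lam)/lam, so the parameter y drops by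
  \<open>lam\<close>; the inner derivative supplies a factor \<open>lam\<close> that cancels the
  denominator of y/lam.\<close>

lemma fps_deriv_degen_exp:
  assumes "lam \<noteq> 0" and "1 + lam * fps_nth F 0 > 0"
  shows "fps_deriv (degen_exp lam y F) = fps_const y * fps_deriv F * degen_exp lam (y - lam) F"
proof -
  have "fps_deriv (degen_exp lam y F) =
      fps_const (y / lam) * (fps_const lam * fps_deriv F) * degen_exp lam (y - lam) F"
    using assms by (simp add: degen_exp_def fps_deriv_powr diff_divide_distrib)
  also have "\<dots> = (fps_const (y / lam) * fps_const lam) * fps_deriv F * degen_exp lam (y - lam) F"
    by (simp only: ac_simps)
  finally show ?thesis
    using assms(1) by simp
qed

lemma degen_Stirling2_0_0: "degen_Stirling2 lam 0 0 = 1"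
  by (simp add: degen_Stirling2_def)

lemma degen_Stirling2_Suc_0: "degen_Stirling2 lam (Suc n) 0 = 0"
  by (simp add: degen_Stirling2_def)

text \<open>With P_k = (E - 1)^k / k! the equation (1 + lam t) E' = E gives (1 + lam t) P_(k+1)' = E
  P_k = (k+1) P_(k+1) + P_k. The recurrence is the coefficient of t^n, scaled by n!.\<close>

lemma degen_Stirling2_Suc_Suc:
  assumes "lam \<noteq> 0"
  shows "degen_Stirling2 lam (Suc n) (Suc k) =
    degen_Stirling2 lam n k + (real (Suc k) - real n * lam) * degen_Stirling2 lam n (Suc k)"
proof -
  define E where "E = degen_exp lam 1 fps_X"
  define P where "P k = fps_const (1 / fact k) * (E - 1) ^ k" for k
  have "fps_deriv E = degen_exp lam (1 - lam) fps_X"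
    using assms by (simp add: E_def fps_deriv_degen_exp)
  \<comment> \<open>The factor 1 + lam t is the degenerate exponential with exponent
    \<open>lam\<close>, so it raises the exponent 1 - lam of E' back to 1.\<close>
  then have dE: "(1 + fps_const lam * fps_X) * fps_deriv E = E"
    using degen_exp_add[of lam fps_X lam "1 - lam"] assms
    by (simp add: E_def degen_exp_lam)
  have scale: "fps_const (1 / fact (Suc k)) * of_nat (Suc k) = fps_const (1 / fact k :: real)"
    by (simp flip: fps_of_nat del: of_nat_Suc)
  have "(1 + fps_const lam * fps_X) * fps_deriv (P (Suc k)) =
      (fps_const (1 / fact (Suc k)) * of_nat (Suc k)) *
        ((1 + fps_const lam * fps_X) * fps_deriv E) * (E - 1) ^ k"
    by (simp add: P_def fps_deriv_power' ac_simps del: of_nat_Suc fact_Suc power_Suc)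
  \<comment> \<open>Here E is split as (E - 1) + 1, which brings back powers of E - 1.\<close>
  also have "\<dots> = fps_const (1 / fact k) * ((E - 1) ^ Suc k + (E - 1) ^ k)"
    unfolding dE scale by (simp add: algebra_simps)
  also have "\<dots> = of_nat (Suc k) * P (Suc k) + P k"
    unfolding P_def using scale by (simp add: algebra_simps del: of_nat_Suc fact_Suc power_Suc)
  finally have "fps_nth ((1 + fps_const lam * fps_X) * fps_deriv (P (Suc k))) n =
      fps_nth (of_nat (Suc k) * P (Suc k) + P k) n"
    by simp
  then have "real (Suc n) * fps_nth (P (Suc k)) (Suc n) + lam * real n * fps_nth (P (Suc k)) n =
      real (Suc k) * fps_nth (P (Suc k)) n + fps_nth (P k) n"
    \<comment> \<open>The factor t shifts the index: t P' has coefficient n p_n at t^n, read off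
      from the predecessor of n if n > 0 and zero if n = 0.\<close>
    by (cases n) (simp_all add: distrib_right mult.assoc fps_mult_of_nat_nth del: of_nat_Suc)
  then have "real (Suc n) * fps_nth (P (Suc k)) (Suc n) =
      (real (Suc k) - real n * lam) * fps_nth (P (Suc k)) n + fps_nth (P k) n"
    by (simp add: algebra_simps)
  then have "fact n * (real (Suc n) * fps_nth (P (Suc k)) (Suc n)) =
      fact n * ((real (Suc k) - real n * lam) * fps_nth (P (Suc k)) n + fps_nth (P k) n)"
    by simp
  moreover have "degen_Stirling2 lam n k = fact n * fps_nth (P k) n" for n k
    by (simp add: degen_Stirling2_def P_def E_def)
  ultimately show ?thesis
    by (simp add: algebra_simps)
qed

text \<open>This is the summation half of the induction step, kept free of generating functions by
  an arbitrary T. The T j terms are reindexed to meet the T (Suc j) terms, and the Stirling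
  recurrence merges the two.\<close>

lemma sum_degen_Stirling2_Suc:
  fixes T :: "nat \<Rightarrow> real fps"
  assumes "lam \<noteq> 0"
  shows "(\<Sum>j\<le>m. fps_const (degen_Stirling2 lam m j) *
            (fps_const (real j - real m * lam) * T j + T (Suc j))) =
    (\<Sum>j\<le>Suc m. fps_const (degen_Stirling2 lam (Suc m) j) * T j)"
proof -
  let ?S = "degen_Stirling2 lam"
  define a where "a j = fps_const (?S m j * (real j - real m * lam)) * T j" for j
  \<comment> \<open>For m = 0 the factor j - m lam vanishes, and for m > 0 the Stirling number does.
    With \<open>a (Suc m) = 0\<close> both ends are zero, so the index can be shifted by
    one.\<close>
  have "a 0 = 0"
    by (cases m) (simp_all add: a_def degen_Stirling2_Suc_0)
  moreover have "a (Suc m) = 0"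
    by (simp add: a_def degen_Stirling2_eq_0)
  ultimately have "(\<Sum>j\<le>m. a j) = (\<Sum>j\<le>m. a (Suc j))"
    using sum.atMost_Suc[of a m] sum.atMost_Suc_shift[of a m] by simp
  then have "(\<Sum>j\<le>m. fps_const (?S m j) * (fps_const (real j - real m * lam) * T j + T (Suc j))) =
      (\<Sum>j\<le>m. a (Suc j) + fps_const (?S m j) * T (Suc j))"
    by (simp add: a_def distrib_left sum.distrib flip: mult.assoc)
  also have "\<dots> = (\<Sum>j\<le>m. fps_const (?S (Suc m) (Suc j)) * T (Suc j))"
    by (simp only: a_def degen_Stirling2_Suc_Suc[OF assms] distrib_right[symmetric] fps_const_add)
      (simp add: algebra_simps)
  also have "\<dots> = (\<Sum>j\<le>Suc m. fps_const (?S (Suc m) j) * T j)"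
    by (simp only: sum.atMost_Suc_shift degen_Stirling2_Suc_0) simp
  finally show ?thesis .
qed

definition degen_Bell2_gf :: "real \<Rightarrow> real \<Rightarrow> real \<Rightarrow> real fps" where
  "degen_Bell2_gf lam x y =
     degen_exp lam y (fps_const x * degen_exp lam 1 fps_X) / fps_const (degen_exp_real lam x)"

lemma fps_deriv_degen_Bell2_gf:
  assumes "lam \<noteq> 0" and "1 + lam * x > 0"
  shows "fps_deriv (degen_Bell2_gf lam x y) =
    fps_const (y * x) * degen_exp lam (1 - lam) fps_X * degen_Bell2_gf lam x (y - lam)"
proof -
  define F where "F = fps_const x * degen_exp lam 1 fps_X"
  define c where "c = degen_exp_real lam x"
  have c: "c \<noteq> 0"
    using assms(2) by (simp add: c_def degen_exp_real_def)
  have gf: "degen_Bell2_gf lam x z = degen_exp lam z F * fps_const (inverse c)" for z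
    using c by (simp add: degen_Bell2_gf_def F_def c_def fps_divide_unit fps_const_inverse)
  \<comment> \<open>The constant term of F is x because E has constant term 1; the hypothesis on x
    thus makes the real power of 1 + lam F legitimate.\<close>
  have F0: "1 + lam * fps_nth F 0 > 0"
    using assms(2) by (simp add: F_def degen_exp_def fps_powr_nth_0)
  have dF: "fps_deriv F = fps_const x * degen_exp lam (1 - lam) fps_X"
    using assms(1) by (simp add: F_def fps_deriv_degen_exp)
  show ?thesis
    unfolding gf by (simp add: fps_deriv_degen_exp[OF assms(1) F0] dF ac_simps
        flip: fps_const_mult)
qed

lemma fps_deriv_funpow_degen_Bell2_gf:
  assumes "lam \<noteq> 0" and "1 + lam * x > 0"
  shows "(fps_deriv ^^ m) (degen_Bell2_gf lam x y) =
    (\<Sum>j\<le>m. fps_const (degen_Stirling2 lam m j) * (fps_const (degen_ffact lam y j * x ^ j) *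
       degen_exp lam (real j - real m * lam) fps_X * degen_Bell2_gf lam x (y - real j * lam)))"
proof (induction m)
  case 0
  show ?case
    by (simp add: degen_Stirling2_0_0 degen_ffact_def degen_exp_0)
next
  case (Suc m)
  let ?E = "\<lambda>a. degen_exp lam a fps_X" and ?G = "degen_Bell2_gf lam x"
  let ?f = "\<lambda>j. degen_ffact lam y j * x ^ j"
  \<comment> \<open>The exponent already carries \<open>Suc m\<close>. Differentiating E^(j - m lam)
    lowers it to that of T j; differentiating G adds 1 - lam to the exponent and shifts y by
    \<open>lam\<close>, which gives T (Suc j).\<close>
  define T where "T j = fps_const (?f j) * ?E (real j - real (Suc m) * lam) * ?G (y - real j * lam)"
    for j
  have step: "fps_deriv (fps_const (?f j) * ?E (real j - real m * lam) * ?G (y - real j * lam)) =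
      fps_const (real j - real m * lam) * T j + T (Suc j)" for j
  proof -
    let ?A = "?E (real j - real m * lam)" and ?d = "real j - real m * lam"
    have dA: "fps_deriv ?A = fps_const ?d * ?E (real j - real (Suc m) * lam)"
      using assms(1) by (simp add: fps_deriv_degen_exp algebra_simps)
    have A: "?A * ?E (1 - lam) = ?E (real (Suc j) - real (Suc m) * lam)"
      by (subst degen_exp_add[symmetric]) (simp_all add: algebra_simps)
    have f: "?f j * ((y - real j * lam) * x) = ?f (Suc j)"
      by (simp add: degen_ffact_def)
    have y: "y - real j * lam - lam = y - real (Suc j) * lam"
      by (simp add: algebra_simps)
    have "fps_deriv (fps_const (?f j) * ?A * ?G (y - real j * lam)) =
        fps_const (?f j) * fps_deriv ?A * ?G (y - real j * lam) +
        fps_const (?f j) * ?A * fps_deriv (?G (y - real j * lam))"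
      by (simp add: algebra_simps del: fps_const_mult)
    also have "\<dots> = fps_const ?d * T j +
        (fps_const (?f j) * fps_const ((y - real j * lam) * x)) * (?A * ?E (1 - lam)) *
          ?G (y - real j * lam - lam)"
      unfolding dA T_def fps_deriv_degen_Bell2_gf[OF assms] by (simp only: ac_simps)
    finally show ?thesis
      by (simp only: fps_const_mult f A y T_def)
  qed
  have "(fps_deriv ^^ Suc m) (?G y) = (\<Sum>j\<le>m. fps_const (degen_Stirling2 lam m j) *
      (fps_const (real j - real m * lam) * T j + T (Suc j)))"
    by (simp add: Suc.IH fps_deriv_sum step del: fps_deriv_mult)
  then show ?case
    unfolding sum_degen_Stirling2_Suc[OF assms(1)] by (simp only: T_def)
qed

lemma fact_mult_fps_nth_funpow_deriv:
  fixes F :: "real fps"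
  shows "fact n * fps_nth ((fps_deriv ^^ m) F) n = fact (n + m) * fps_nth F (n + m)"
\<comment> \<open>The outermost derivative is peeled off, which moves the coefficient index to
  \<open>Suc n\<close>; hence n must vary.\<close>
proof (induction m arbitrary: n)
  case 0
  show ?case by simp
next
  case (Suc m)
  have "fact n * fps_nth ((fps_deriv ^^ Suc m) F) n =
      fact (Suc n) * fps_nth ((fps_deriv ^^ m) F) (Suc n)"
    by (simp add: algebra_simps)
  also have "\<dots> = fact (n + Suc m) * fps_nth F (n + Suc m)"
    using Suc.IH[of "Suc n"] by simp
  finally show ?case .
qed

text \<open>A product of exponential generating functions has the binomial convolution as its
  coefficients. The proof swaps the factors so that k indexes the Bell polynomials.\<close>

lemma fact_mult_fps_nth_degen_exp_mult_gf:
  assumes "lam \<noteq> 0"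
  shows "fact n * fps_nth (degen_exp lam a fps_X * degen_Bell2_gf lam x z) n =
    (\<Sum>k=0..n. real (n choose k) * degen_ffact lam a (n - k) * degen_Bell2 lam k x z)"
proof -
  have "fact n * fps_nth (degen_Bell2_gf lam x z * degen_exp lam a fps_X) n =
      (\<Sum>k=0..n. fact n * (fps_nth (degen_Bell2_gf lam x z) k *
         (degen_ffact lam a (n - k) / fact (n - k))))"
    using assms by (simp add: fps_mult_nth degen_exp_fps_X sum_distrib_left)
  also have "\<dots> =
      (\<Sum>k=0..n. real (n choose k) * degen_ffact lam a (n - k) * degen_Bell2 lam k x z)"
    by (intro sum.cong refl)
      (simp add: degen_Bell2_def degen_Bell2_gf_def binomial_fact field_simps)
  finally show ?thesis
    by (simp add: mult.commute)
qed

lemma degen_Bell2_add: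
  assumes "lam \<noteq> 0" and "1 + lam * x > 0"
  shows "degen_Bell2 lam (n + m) x y =
    (\<Sum>j=0..m. \<Sum>k=0..n. degen_Stirling2 lam m j * real (n choose k) *
       degen_ffact lam (real j - real m * lam) (n - k) *
       degen_ffact lam y j * x ^ j * degen_Bell2 lam k x (y - real j * lam))"
proof -
  have "degen_Bell2 lam (n + m) x y =
      fact n * fps_nth ((fps_deriv ^^ m) (degen_Bell2_gf lam x y)) n"
    by (simp add: fact_mult_fps_nth_funpow_deriv degen_Bell2_def degen_Bell2_gf_def)
  also have "\<dots> = (\<Sum>j\<le>m. degen_Stirling2 lam m j * (degen_ffact lam y j * x ^ j) *
      (fact n * fps_nth (degen_exp lam (real j - real m * lam) fps_X *
         degen_Bell2_gf lam x (y - real j * lam)) n))"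
    by (simp add: fps_deriv_funpow_degen_Bell2_gf[OF assms] fps_sum_nth sum_distrib_left
        mult.assoc mult.left_commute flip: fps_const_mult)
  also have "\<dots> = (\<Sum>j=0..m. \<Sum>k=0..n. degen_Stirling2 lam m j * real (n choose k) *
       degen_ffact lam (real j - real m * lam) (n - k) *
       degen_ffact lam y j * x ^ j * degen_Bell2 lam k x (y - real j * lam))"
    unfolding fact_mult_fps_nth_degen_exp_mult_gf[OF assms(1)]
    by (simp add: sum_distrib_left atLeast0AtMost ac_simps)
  finally show ?thesis .
qed

theorem theorem2p8:
  fixes lam x y :: real and n m :: nat
  assumes "lam \<noteq> 0" and "1 + lam * x > 0"
  shows "degen_Bell2 lam (n + m) x y =
           (\<Sum>j=0..m. \<Sum>k=0..n.
              degen_Stirling2 lam m j * real (n choose k) *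
              degen_ffact lam (real j - real m * lam) (n - k) *
              degen_ffact lam y j * x ^ j *
              degen_Bell2 lam k x (y - real j * lam)) \<and>
         degen_Bell lam (n + m) x =
           (\<Sum>j=0..m. \<Sum>k=0..n.
              degen_Stirling2 lam m j * real (n choose k) *
              degen_ffact lam (real j - real m * lam) (n - k) *
              degen_ffact lam 1 j * x ^ j *
              degen_Bell2 lam k x (1 - real j * lam))"
proof -
  have "degen_Bell lam (n + m) x = degen_Bell2 lam (n + m) x 1"
    by (simp add: degen_Bell_def degen_Bell2_def)
  then show ?thesis
    by (simp only: degen_Bell2_add[OF assms] simp_thms)
qed

end
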